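(* Suppose $F$ satisfies conditions (A0), (A1) and (A2) with constants $\kappa_1,\kappa_2$, and let $\varepsilon>0$. If $\lambda\ge8\kappa_1/\varepsilon$ and $\gamma\ge4\kappa_2/\varepsilon$, then the estimator $\widetilde\theta$ is $(\varepsilon,0)$ edge differentially private.
   Context: Data: a comparison graph $\mathcal G$ on the item set $[n]=\{1,\dots,n\}$ (edges written $(i,j)$, each counted once) and outcomes $y_{ij}\in\{0,1\}$ for $(i,j)\in\mathcal G$, with $y_{ji}=1-y_{ij}$. Regularity conditions on $F$ ($F$ is twice differentiable): (A0) $F:\mathbb R\to[0,1]$ is strictly increasing and $F(x)=1-F(-x)$ for all $x$. (A1) There is an absolute constant $\kappa_1>0$ with $\sup_{x}\frac{F'(x)}{F(x)(1-F(x))}<\kappa_1$. (A2) $\frac{\partial^2}{\partial x^2}(-\log F(x))>0$ for all $x$, and there is an absolute constant $\kappa_2>0$ with $\frac{\partial^2}{\partial x^2}(-\log F(x))<\kappa_2$ for all $x$ and $\min_{|x|\le 4}\frac{\partial^2}{\partial x^2}(-\log F(x))>1/\kappa_2$. Estimator. With $F_{ij}(\theta)=F(\theta_i-\theta_j)$ and $\mathcal L(\theta;y)=\sum_{(i,j)\in\mathcal G}\left[-y_{ij}\log F_{ij}(\theta)-y_{ji}\log(1-F_{ij}(\theta))\right]$, $$\widetilde\theta=\arg\min_{\theta\in\mathbb R^n}\ \mathcal L(\theta;y)+\frac{\gamma}{2}\|\theta\|_2^2+w^\top\theta,$$ where $w=(w_1,\dots,w_n)$ has i.i.d. Laplace entries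 with scale $\lambda$ (density $\frac{1}{2\lambda}e^{-|x|/\lambda}$), independent of the data. Edge differential privacy. Two comparison data sets $(\mathcal G,(y_{ij})_{(i,j)\in\mathcal G})$ and $(\mathcal G',(y'_{ij})_{(i,j)\in\mathcal G'})$ are adjacent if either $\mathcal G=\mathcal G'$ and the outcomes differ on exactly one edge, or $\mathcal G$ is obtained from $\mathcal G\cap\mathcal G'$ by adding one edge and $\mathcal G'$ by adding one different edge, with all outcomes on $\mathcal G\cap\mathcal G'$ equal. A randomized algorithm $M$ is $(\varepsilon,\delta)$ edge differentially private if $\Pr(M(X)\in A)\le e^{\varepsilon}\Pr(M(X')\in A)+\delta$ for all adjacent $X,X'$ and all measurable $A$. *)

theory Defs
  imports "HOL-Probability.Probability"
begin

text \<open>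
  The item set \<open>[n]\<close> is the finite linearly ordered index type \<^typ>\<open>'n\<close>, with
  \<open>n = CARD('n)\<close>. The order only serves to fix one orientation per edge: an (undirected)
  edge is stored as the pair \<open>(i, j)\<close> with \<open>i < j\<close>, so every edge is counted once.
  The second component of a data set gives the outcomes \<open>y i j\<close>; its values off the
  graph are irrelevant.
\<close>

type_synonym 'n dataset = "('n \<times> 'n) set \<times> ('n \<Rightarrow> 'n \<Rightarrow> real)"

definition comparison_data :: "'n::{finite,linorder} dataset \<Rightarrow> bool" where
  "comparison_data X \<longleftrightarrow> (case X of (G, y) \<Rightarrow>
     \<forall>(i, j)\<in>G. i < j \<and> y i j \<in> {0, 1} \<and> y j i = 1 - y i j)"

definition adjacent :: "'n::{finite,linorder} dataset \<Rightarrow> 'n dataset \<Rightarrow> bool" where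
  "adjacent X X' \<longleftrightarrow> (case (X, X') of ((G, y), (G', y')) \<Rightarrow>
     comparison_data X \<and> comparison_data X' \<and>
     ((G = G' \<and> (\<exists>!e. e \<in> G \<and> y (fst e) (snd e) \<noteq> y' (fst e) (snd e))) \<or>
      ((\<exists>e e'. e \<notin> G \<inter> G' \<and> e' \<notin> G \<inter> G' \<and> e \<noteq> e' \<and>
          G = insert e (G \<inter> G') \<and> G' = insert e' (G \<inter> G')) \<and>
       (\<forall>(i, j)\<in>G \<inter> G'. y i j = y' i j))))"

text \<open>
  The randomness of an algorithm is carried by a probability space \<open>P\<close>; on input \<open>X\<close>
  the output is the random variable \<open>M X\<close>. Measurability is demanded explicitly, since
  \<^const>\<open>measure\<close> is 0 on non-measurable sets.
\<close>

definition edge_differentially_private ::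
    "'w measure \<Rightarrow> ('n::{finite,linorder} dataset \<Rightarrow> 'w \<Rightarrow> 'b::topological_space) \<Rightarrow> real \<Rightarrow> real \<Rightarrow> bool"
  where
  "edge_differentially_private P M \<epsilon> \<delta> \<longleftrightarrow>
     prob_space P \<and>
     (\<forall>X. comparison_data X \<longrightarrow> M X \<in> borel_measurable P) \<and>
     (\<forall>X X'. adjacent X X' \<longrightarrow> (\<forall>A\<in>sets borel.
        measure P {\<omega>\<in>space P. M X \<omega> \<in> A}
          \<le> exp \<epsilon> * measure P {\<omega>\<in>space P. M X' \<omega> \<in> A} + \<delta>))"

definition twice_differentiable :: "(real \<Rightarrow> real) \<Rightarrow> bool" where
  "twice_differentiable F \<longleftrightarrow>
     (\<forall>x. F differentiable (at x)) \<and> (\<forall>x. deriv F differentiable (at x))"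

definition cond_A0 :: "(real \<Rightarrow> real) \<Rightarrow> bool" where
  "cond_A0 F \<longleftrightarrow> (\<forall>x. F x \<in> {0..1}) \<and> strict_mono F \<and> (\<forall>x. F x = 1 - F (- x))"

text \<open>
  The real-valued supremum is unspecified on unbounded sets, hence the boundedness clause.
\<close>

definition cond_A1 :: "(real \<Rightarrow> real) \<Rightarrow> real \<Rightarrow> bool" where
  "cond_A1 F \<kappa>\<^sub>1 \<longleftrightarrow> \<kappa>\<^sub>1 > 0 \<and>
     bdd_above (range (\<lambda>x. deriv F x / (F x * (1 - F x)))) \<and>
     (SUP x. deriv F x / (F x * (1 - F x))) < \<kappa>\<^sub>1"

definition neg_log_deriv2 :: "(real \<Rightarrow> real) \<Rightarrow> real \<Rightarrow> real" where
  "neg_log_deriv2 F = deriv (deriv (\<lambda>x. - ln (F x)))"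

text \<open>
  The second derivative need not be continuous, so its minimum over \<open>[-4, 4]\<close> is read as
  an infimum; this agrees with the minimum whenever that is attained.
\<close>

definition cond_A2 :: "(real \<Rightarrow> real) \<Rightarrow> real \<Rightarrow> bool" where
  "cond_A2 F \<kappa>\<^sub>2 \<longleftrightarrow> (\<forall>x. neg_log_deriv2 F x > 0) \<and> \<kappa>\<^sub>2 > 0 \<and>
     (\<forall>x. neg_log_deriv2 F x < \<kappa>\<^sub>2) \<and>
     (INF x\<in>{x. \<bar>x\<bar> \<le> 4}. neg_log_deriv2 F x) > 1 / \<kappa>\<^sub>2"

definition neg_log_lik :: "(real \<Rightarrow> real) \<Rightarrow> 'n::{finite,linorder} dataset \<Rightarrow> (real, 'n) vec \<Rightarrow> real" where
  "neg_log_lik F X \<theta> = (case X of (G, y) \<Rightarrow>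
     \<Sum>(i, j)\<in>G. - y i j * ln (F (\<theta> $ i - \<theta> $ j)) - y j i * ln (1 - F (\<theta> $ i - \<theta> $ j)))"

text \<open>
  For the parameters of interest the objective has a unique minimiser, so the choice made by
  \<^const>\<open>arg_min\<close> is immaterial.
\<close>

definition private_mle ::
    "(real \<Rightarrow> real) \<Rightarrow> real \<Rightarrow> 'n::{finite,linorder} dataset \<Rightarrow> (real, 'n) vec \<Rightarrow> (real, 'n) vec" where
  "private_mle F \<gamma> X w =
     (ARG_MIN (\<lambda>\<theta>. neg_log_lik F X \<theta> + \<gamma> / 2 * (norm \<theta>)\<^sup>2 + w \<bullet> \<theta>) \<theta>. True)"

definition laplace_density :: "real \<Rightarrow> real \<Rightarrow> real" where
  "laplace_density lam x = 1 / (2 * lam) * exp (- \<bar>x\<bar> / lam)"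

definition iid_laplace :: "'w measure \<Rightarrow> real \<Rightarrow> ('w \<Rightarrow> real ^ 'n) \<Rightarrow> bool" where
  "iid_laplace P lam w \<longleftrightarrow>
     prob_space.indep_vars P (\<lambda>_. borel) (\<lambda>i \<omega>. w \<omega> $ i) UNIV \<and>
     (\<forall>i. distributed P lborel (\<lambda>\<omega>. w \<omega> $ i) (\<lambda>x. ennreal (laplace_density lam x)))"

end

theory Submission
  imports Defs
begin

text \<open>
  Write \<open>T\<^sub>X \<theta> = - \<nabla>L(\<theta>) - \<gamma> \<theta>\<close> for the noise vector whose minimiser is \<open>\<theta>\<close>. Since \<open>- ln \<circ> F\<close> is
  convex, \<open>T\<^sub>X\<close> is a bijection with Lipschitz inverse, so by a change of variables the estimator has
  density \<open>\<theta> \<mapsto> \<bar>det DT\<^sub>X(\<theta>)\<bar> g(T\<^sub>X \<theta>)\<close>, where \<open>g\<close> is the density of the Laplace vector. Adjacent data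
  sets differ by exchanging one signed edge for another. Each exchange moves \<open>T\<^sub>X \<theta>\<close> by at most
  \<open>4 \<kappa>\<^sub>1 \<le> \<epsilon> lam / 2\<close> in the 1-norm and changes the Jacobian by two rank-one terms, hence, by the matrix
  determinant lemma, by a factor of at most \<open>1 + 2 \<kappa>\<^sub>2 / \<gamma> \<le> exp (\<epsilon> / 2)\<close>.
\<close>

section \<open>Rank-one perturbations of the determinant\<close>

definition outer :: "real^'n \<Rightarrow> real^'m \<Rightarrow> real^'m^'n" where
  "outer u v = (\<chi> i j. u $ i * v $ j)"

lemma mat_one_nth: "mat 1 $ i $ j = (if i = j then 1 else 0)"
  by (simp add: mat_def)

lemma outer_vector_mult [simp]: "outer u v *v x = (v \<bullet> x) *\<^sub>R u"
  by (simp add: outer_def matrix_vector_mult_def vec_eq_iff inner_vec_def sum_distrib_right sum_distrib_left ac_simps)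

lemma matrix_mult_outer: "B ** outer u v = outer (B *v u) v" for B :: "real^'n^'k"
  by (simp add: matrix_eq matrix_vector_mul_assoc[symmetric] matrix_vector_mult_scaleR)

text \<open>An orthogonal change of basis makes \<open>v\<close> a multiple of a basis vector, so that only one column
  differs from the identity.\<close>

lemma det_one_plus_outer:
  fixes u v :: "real^'n"
  shows "det (mat 1 + outer u v) = 1 + u \<bullet> v"
proof (cases "v = 0")
  case True
  then have "outer u v = 0"
    by (simp add: outer_def vec_eq_iff)
  then show ?thesis
    using True by simp
next
  case False
  \<comment> \<open>Any index works here; \<open>undefined\<close> merely names one.\<close>
  define k :: 'n where "k = undefined"
  obtain Q :: "real^'n^'n" where Q: "orthogonal_matrix Q" "Q *v axis k 1 = v /\<^sub>R norm v"
    using orthogonal_matrix_exists_basis[of "v /\<^sub>R norm v" k] False by auto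
  have QQ: "transpose Q ** Q = mat 1" "Q ** transpose Q = mat 1"
    using Q(1) by (auto simp: orthogonal_matrix_def)
  have "transpose Q *v (v /\<^sub>R norm v) = axis k 1"
    by (metis Q(2) QQ(1) matrix_vector_mul_assoc matrix_vector_mul_lid)
  then have Qv: "transpose Q *v v = norm v *\<^sub>R axis k 1"
    using False by (metis divideR_right matrix_vector_mult_scaleR norm_eq_zero)
  let ?u = "norm v *\<^sub>R (transpose Q *v u)"
  \<comment> \<open>The conjugated matrix is the identity with column \<open>k\<close> replaced.
    Writing the new column as \<open>mat 1 *v _\<close> gives the shape of
    \<open>cramer_lemma\<close>, which reads the determinant off as one coordinate.\<close>
  have eq: "transpose Q ** (mat 1 + outer u v) ** Q
      = (\<chi> i j. if j = k then (mat 1 *v (axis k 1 + ?u)) $ i else mat 1 $ i $ j)"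
  proof -
    have "transpose Q ** (mat 1 + outer u v) ** Q = mat 1 + outer (transpose Q *v u) (transpose Q *v v)"
    proof (subst matrix_eq, rule allI)
      fix x
      have "transpose Q *v (Q *v x) = x"
        by (metis QQ(1) matrix_vector_mul_assoc matrix_vector_mul_lid)
      moreover have "v \<bullet> (Q *v x) = (transpose Q *v v) \<bullet> x"
        by (simp add: dot_lmul_matrix)
      ultimately show "(transpose Q ** (mat 1 + outer u v) ** Q) *v x
          = (mat 1 + outer (transpose Q *v u) (transpose Q *v v)) *v x"
        by (simp add: matrix_vector_mul_assoc[symmetric] matrix_vector_mult_add_rdistrib
            matrix_vector_right_distrib matrix_vector_mult_scaleR del: transpose_matrix_vector)
    qed
    then show ?thesis
      unfolding Qv matrix_vector_mul_lid
      by (simp add: vec_eq_iff outer_def axis_def mat_one_nth del: transpose_matrix_vector)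
  qed
  have "det (mat 1 + outer u v) = det (transpose Q ** (mat 1 + outer u v) ** Q)"
    using arg_cong[OF QQ(1), of det] by (simp add: det_mul)
  also have "\<dots> = (axis k 1 + ?u) $ k * det (mat 1 :: real^'n^'n)"
    unfolding eq by (rule cramer_lemma)
  also have "\<dots> = 1 + norm v * (transpose Q *v u) $ k"
    by simp
  also have "norm v * (transpose Q *v u) $ k = (transpose Q *v u) \<bullet> (transpose Q *v v)"
    unfolding Qv by (simp add: inner_axis)
  also have "\<dots> = u \<bullet> v"
    by (metis QQ(2) dot_lmul_matrix matrix_vector_mul_assoc matrix_vector_mul_lid transpose_matrix_vector transpose_transpose)
  finally show ?thesis .
qed

text \<open>Coercivity makes \<open>B\<close> invertible. With \<open>B *v u = v\<close>, the matrix
  determinant lemma yields \<open>s = u \<bullet> v\<close>, which does not depend on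
  \<open>h\<close>. Coercivity at \<open>u\<close> bounds \<open>s\<close> below by
  \<open>\<gamma> * (norm u)\<^sup>2\<close>; with Cauchy-Schwarz this gives
  \<open>\<gamma> * norm u \<le> norm v\<close>, and a second use of Cauchy-Schwarz gives the upper
  bound.\<close>

lemma det_rank_one_update:
  fixes B :: "real^'n^'n" and v :: "real^'n"
  assumes "\<gamma> > 0" and coercive: "\<And>x. \<gamma> * (norm x)\<^sup>2 \<le> x \<bullet> (B *v x)"
  obtains s where "0 \<le> s" "s \<le> (norm v)\<^sup>2 / \<gamma>" "\<And>h. det (B + h *\<^sub>R outer v v) = det B * (1 + h * s)"
proof -
  have "x = 0" if "B *v x = 0" for x
    using coercive[of x] that \<open>\<gamma> > 0\<close> by (simp add: mult_le_0_iff)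
  then obtain C where C: "C ** B = mat 1"
    using matrix_left_invertible_ker by blast
  then have "B ** C = mat 1"
    using matrix_left_right_inverse by blast
  define u where "u = C *v v"
  have Bu: "B *v u = v"
    by (simp add: u_def matrix_vector_mul_assoc \<open>B ** C = mat 1\<close>)
  have le: "\<gamma> * (norm u)\<^sup>2 \<le> u \<bullet> v"
    using coercive[of u] by (simp add: Bu)
  then have "\<gamma> * (norm u)\<^sup>2 \<le> norm u * norm v"
    using norm_cauchy_schwarz order_trans by blast
  then have "\<gamma> * norm u \<le> norm v"
    by (cases "norm u = 0") (simp_all add: power2_eq_square mult.left_commute)
  then have "\<gamma> * (u \<bullet> v) \<le> norm v * norm v"
    using norm_cauchy_schwarz[of u v] \<open>\<gamma> > 0\<close>
    by (smt (verit, best) mult.assoc mult_left_mono mult_right_mono norm_ge_zero)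
  then have up: "u \<bullet> v \<le> (norm v)\<^sup>2 / \<gamma>"
    using \<open>\<gamma> > 0\<close> by (simp add: field_simps power2_eq_square)
  have "det (B + h *\<^sub>R outer v v) = det B * (1 + h * (u \<bullet> v))" for h
  proof -
    have "B + h *\<^sub>R outer v v = B ** (mat 1 + outer (h *\<^sub>R u) v)"
      by (simp add: matrix_add_ldistrib matrix_mult_outer Bu matrix_vector_mult_scaleR)
         (simp add: outer_def vec_eq_iff)
    then show ?thesis
      by (simp add: det_mul det_one_plus_outer)
  qed
  then show thesis
    using that[of "u \<bullet> v"] le up \<open>\<gamma> > 0\<close> by (smt (verit) zero_le_mult_iff zero_le_power2)
qed

section \<open>Ridge-regularised convex losses\<close>

lemma has_derivative_compose_inner:
  fixes g :: "real \<Rightarrow> real"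
  assumes "(g has_real_derivative d) (at (v \<bullet> x))"
  shows "((\<lambda>x. g (v \<bullet> x)) has_derivative (\<lambda>h. d * (v \<bullet> h))) (at x within S)"
  using assms has_derivative_compose[OF has_derivative_inner_right[OF has_derivative_ident]]
  unfolding has_field_derivative_def by fast

text \<open>\<open>f\<close> models the negative logarithm of \<open>F\<close>. Convexity together
  with the ridge makes the noise map expansive; nonnegativity together with the ridge makes the
  objective coercive.\<close>

locale convex_loss =
  fixes f f' f'' :: "real \<Rightarrow> real" and \<gamma> :: real
  assumes DERIV_f: "\<And>x. (f has_real_derivative f' x) (at x)"
    and DERIV_f': "\<And>x. (f' has_real_derivative f'' x) (at x)"
    and f_nonneg: "\<And>x. 0 \<le> f x"
    and f''_nonneg: "\<And>x. 0 \<le> f'' x"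
    and \<gamma>_pos: "0 < \<gamma>"
begin

text \<open>The outcome of an edge \<open>e\<close> is absorbed into the sign of \<open>v e\<close>,
  so that every edge carries the same loss \<open>f\<close>.\<close>

definition objective :: "'e set \<Rightarrow> ('e \<Rightarrow> real^'n) \<Rightarrow> real^'n \<Rightarrow> real^'n \<Rightarrow> real" where
  "objective G v w \<theta> = (\<Sum>e\<in>G. f (v e \<bullet> \<theta>)) + \<gamma> / 2 * (norm \<theta>)\<^sup>2 + w \<bullet> \<theta>"

text \<open>The noise vector for which \<open>\<theta>\<close> is the stationary point of the objective.\<close>

definition noise_at :: "'e set \<Rightarrow> ('e \<Rightarrow> real^'n) \<Rightarrow> real^'n \<Rightarrow> real^'n" where
  "noise_at G v \<theta> = - (\<Sum>e\<in>G. f' (v e \<bullet> \<theta>) *\<^sub>R v e) - \<gamma> *\<^sub>R \<theta>"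

definition hessian :: "'e set \<Rightarrow> ('e \<Rightarrow> real^'n) \<Rightarrow> real^'n \<Rightarrow> real^'n^'n" where
  "hessian G v \<theta> = \<gamma> *\<^sub>R mat 1 + (\<Sum>e\<in>G. f'' (v e \<bullet> \<theta>) *\<^sub>R outer (v e) (v e))"

lemma sum_matrix_vector_mult: "(\<Sum>e\<in>G. A e) *v x = (\<Sum>e\<in>G. A e *v x)" for A :: "'e \<Rightarrow> real^'n^'m"
  by (induction G rule: infinite_finite_induct) (simp_all add: matrix_vector_mult_add_rdistrib)

lemma hessian_vector_mult:
  "hessian G v \<theta> *v x = \<gamma> *\<^sub>R x + (\<Sum>e\<in>G. (f'' (v e \<bullet> \<theta>) * (v e \<bullet> x)) *\<^sub>R v e)"
  by (simp add: hessian_def matrix_vector_mult_add_rdistrib sum_matrix_vector_mult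
      scaleR_matrix_vector_assoc[symmetric])

lemma hessian_coercive: "\<gamma> * (norm x)\<^sup>2 \<le> x \<bullet> (hessian G v \<theta> *v x)"
proof -
  have "0 \<le> (\<Sum>e\<in>G. f'' (v e \<bullet> \<theta>) * (v e \<bullet> x)\<^sup>2)"
    by (intro sum_nonneg mult_nonneg_nonneg f''_nonneg) auto
  also have "\<dots> = x \<bullet> (\<Sum>e\<in>G. (f'' (v e \<bullet> \<theta>) * (v e \<bullet> x)) *\<^sub>R v e)"
    unfolding inner_sum_right by (intro sum.cong refl) (simp add: power2_eq_square inner_commute)
  finally show ?thesis
    by (simp add: hessian_vector_mult inner_add_right power2_norm_eq_inner)
qed

lemma noise_at_has_derivative:
  "(noise_at G v has_derivative (\<lambda>h. - (hessian G v \<theta> *v h))) (at \<theta> within S)"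
proof -
  have deriv: "((\<lambda>\<theta>. f' (v e \<bullet> \<theta>)) has_derivative (\<lambda>h. f'' (v e \<bullet> \<theta>) * (v e \<bullet> h))) (at \<theta> within S)" for e
    by (rule has_derivative_compose_inner[OF DERIV_f'])
  have "(noise_at G v has_derivative
      (\<lambda>h. - (\<Sum>e\<in>G. (f'' (v e \<bullet> \<theta>) * (v e \<bullet> h)) *\<^sub>R v e) - \<gamma> *\<^sub>R h)) (at \<theta> within S)"
    unfolding noise_at_def[abs_def]
    by (intro has_derivative_diff has_derivative_minus has_derivative_sum deriv
        has_derivative_scaleR_left has_derivative_scaleR_right has_derivative_ident)
  also have "(\<lambda>h. - (\<Sum>e\<in>G. (f'' (v e \<bullet> \<theta>) * (v e \<bullet> h)) *\<^sub>R v e) - \<gamma> *\<^sub>R h)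
      = (\<lambda>h. - (hessian G v \<theta> *v h))"
    by (simp add: hessian_vector_mult fun_eq_iff)
  finally show ?thesis .
qed

text \<open>Negating a matrix changes its determinant at most by a sign, so the Jacobian factor can
  be computed from the positive definite \<open>hessian\<close>.\<close>

lemma abs_det_noise_at_derivative:
  fixes v :: "'e \<Rightarrow> real^'n"
  shows "\<bar>det (matrix (\<lambda>h. - (hessian G v \<theta> *v h)))\<bar> = \<bar>det (hessian G v \<theta>)\<bar>"
proof -
  let ?H = "hessian G v \<theta>"
  have "matrix (\<lambda>h. - (?H *v h)) = matrix ((*\<^sub>R) (- 1) \<circ> (*v) ?H)"
    by (simp add: o_def)
  also have "\<dots> = matrix ((*\<^sub>R) (- 1)) ** ?H"
    by (subst matrix_compose) (auto intro: linear_compose_scale_right)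
  finally have "matrix (\<lambda>h. - (?H *v h)) = matrix ((*\<^sub>R) (- 1)) ** ?H" .
  then show ?thesis
    by (simp only: det_mul det_matrix_scaleR abs_mult power_abs) simp
qed

lemma f'_mono: "x \<le> y \<Longrightarrow> f' x \<le> f' y"
  using DERIV_f' f''_nonneg by (intro DERIV_nonneg_imp_nondecreasing[of x y f']) auto

text \<open>Since \<open>f'\<close> is nondecreasing, each edge contributes a nonnegative amount,
  and the ridge alone contributes the left-hand side.\<close>

lemma noise_at_strongly_monotone:
  "\<gamma> * (norm (x - y))\<^sup>2 \<le> (noise_at G v y - noise_at G v x) \<bullet> (x - y)"
proof -
  have "0 \<le> (f' a - f' b) * (a - b)" for a b
    using f'_mono[of a b] f'_mono[of b a]
    by (cases "a \<le> b") (simp_all add: mult_nonpos_nonpos)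
  then have "0 \<le> (\<Sum>e\<in>G. (f' (v e \<bullet> x) - f' (v e \<bullet> y)) * (v e \<bullet> x - v e \<bullet> y))"
    by (intro sum_nonneg)
  also have "\<dots> = (\<Sum>e\<in>G. f' (v e \<bullet> x) *\<^sub>R v e - f' (v e \<bullet> y) *\<^sub>R v e) \<bullet> (x - y)"
    unfolding inner_sum_left
    by (intro sum.cong refl) (simp add: inner_diff_right algebra_simps)
  finally have "0 \<le> \<dots>" .
  moreover have "noise_at G v y - noise_at G v x
      = (\<Sum>e\<in>G. f' (v e \<bullet> x) *\<^sub>R v e - f' (v e \<bullet> y) *\<^sub>R v e) + \<gamma> *\<^sub>R (x - y)"
    by (simp add: noise_at_def sum_subtractf scaleR_diff_right)
  ultimately show ?thesis
    by (simp only: inner_add_left inner_scaleR_left power2_norm_eq_inner)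
qed

text \<open>Cauchy-Schwarz applied to strong monotonicity. This one bound yields both injectivity
  and the Lipschitz constant \<open>1 / \<gamma>\<close> of the inverse.\<close>

lemma noise_at_expansive: "\<gamma> * norm (x - y) \<le> norm (noise_at G v x - noise_at G v y)"
proof (cases "x = y")
  case False
  have "\<gamma> * (norm (x - y))\<^sup>2 \<le> norm (noise_at G v y - noise_at G v x) * norm (x - y)"
    using noise_at_strongly_monotone norm_cauchy_schwarz order_trans by blast
  then show ?thesis
    using False by (simp add: power2_eq_square norm_minus_commute)
qed simp

lemma objective_has_derivative:
  "(objective G v w has_derivative (\<lambda>h. (w - noise_at G v \<theta>) \<bullet> h)) (at \<theta>)"
proof -
  have deriv: "((\<lambda>\<theta>. f (v e \<bullet> \<theta>)) has_derivative (\<lambda>h. f' (v e \<bullet> \<theta>) * (v e \<bullet> h))) (at \<theta>)" for e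
    by (rule has_derivative_compose_inner[OF DERIV_f])
  have "(objective G v w has_derivative
      (\<lambda>h. (\<Sum>e\<in>G. f' (v e \<bullet> \<theta>) * (v e \<bullet> h)) + \<gamma> / 2 * (\<theta> \<bullet> h + h \<bullet> \<theta>) + w \<bullet> h)) (at \<theta>)"
    unfolding objective_def[abs_def] power2_norm_eq_inner
    by (intro has_derivative_add has_derivative_sum deriv has_derivative_mult_right
        has_derivative_inner has_derivative_inner_right has_derivative_ident)
  also have "(\<lambda>h. (\<Sum>e\<in>G. f' (v e \<bullet> \<theta>) * (v e \<bullet> h)) + \<gamma> / 2 * (\<theta> \<bullet> h + h \<bullet> \<theta>) + w \<bullet> h)
      = (\<lambda>h. (w - noise_at G v \<theta>) \<bullet> h)"
    unfolding noise_at_def by (simp add: inner_add_right inner_diff_right inner_sum_right inner_commute fun_eq_iff)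
  finally show ?thesis .
qed

lemma objective_minimiser_noise_at:
  assumes "\<And>y. objective G v w \<theta> \<le> objective G v w y"
  shows "noise_at G v \<theta> = w"
proof -
  have "(\<lambda>h. (w - noise_at G v \<theta>) \<bullet> h) = (\<lambda>h. 0)"
    by (rule differential_zero_maxmin[OF UNIV_I open_UNIV objective_has_derivative]) (use assms in auto)
  then show ?thesis
    using inner_eq_zero_iff[of "w - noise_at G v \<theta>"] by (simp add: fun_eq_iff)
qed

text \<open>The ridge dominates the linear noise term far out, so a minimiser over a large closed
  ball is global.\<close>

lemma objective_minimiser_exists:
  obtains \<theta> where "\<And>y. objective G v w \<theta> \<le> objective G v w y"
proof -
  \<comment> \<open>Beyond \<open>R\<close> the quantity
    \<open>\<gamma> / 2 * norm x - norm w\<close> exceeds the objective at 0. The radius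
    \<open>max 1 R\<close> used below also ensures \<open>norm x > 1\<close>, so multiplying by
    \<open>norm x\<close> preserves this lower bound.\<close>
  define R where "R = 2 * (norm w + objective G v w 0 + 1) / \<gamma>"
  have f0: "0 \<le> (\<Sum>e\<in>G. f (v e \<bullet> x))" for x
    by (intro sum_nonneg f_nonneg)
  have o0: "0 \<le> objective G v w 0"
    using f0[of 0] by (simp add: objective_def)
  have "R > 0" using o0 \<gamma>_pos by (simp add: R_def add_nonneg_pos)
  have far: "objective G v w 0 \<le> objective G v w x" if "norm x > max 1 R" for x
  proof -
    have "norm w + objective G v w 0 \<le> \<gamma> / 2 * norm x"
      using that \<gamma>_pos by (simp add: R_def field_simps)
    then have "objective G v w 0 * 1 \<le> (\<gamma> / 2 * norm x - norm w) * norm x"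
      using that o0 by (intro mult_mono) auto
    also have "\<dots> \<le> \<gamma> / 2 * (norm x)\<^sup>2 + w \<bullet> x"
      using norm_cauchy_schwarz[of "- w" x] by (simp add: algebra_simps power2_eq_square)
    also have "\<dots> \<le> objective G v w x"
      using f0[of x] by (simp add: objective_def)
    finally show ?thesis by simp
  qed
  have "continuous_on UNIV (objective G v w)"
    by (meson continuous_at_imp_continuous_on has_derivative_continuous objective_has_derivative)
  then have "continuous_on (cball 0 (max 1 R)) (objective G v w)"
    using continuous_on_subset by blast
  then have "\<exists>\<theta>\<in>cball 0 (max 1 R). \<forall>y\<in>cball 0 (max 1 R). objective G v w \<theta> \<le> objective G v w y"
    by (intro continuous_attains_inf) auto
  then obtain \<theta> where \<theta>: "\<theta> \<in> cball 0 (max 1 R)" "\<forall>y\<in>cball 0 (max 1 R). objective G v w \<theta> \<le> objective G v w y"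
    by blast
  have "objective G v w \<theta> \<le> objective G v w y" for y
  proof (cases "norm y > max 1 R")
    case True
    moreover have "objective G v w \<theta> \<le> objective G v w 0"
      using \<theta>(2) by simp
    ultimately show ?thesis using far by fastforce
  qed (use \<theta>(2) in auto)
  then show thesis by (rule that)
qed

text \<open>Expansiveness gives injectivity. For surjectivity, the objective with noise
  \<open>w\<close> has a minimiser, and its first-order condition says that \<open>noise_at\<close>
  sends it to \<open>w\<close>.\<close>

lemma bij_noise_at: "bij (noise_at G v)"
proof (rule bijI)
  show "inj (noise_at G v)"
  proof (rule injI)
    fix x y assume "noise_at G v x = noise_at G v y"
    then have "\<gamma> * norm (x - y) \<le> 0"
      using noise_at_expansive[of x y G v] by simp
    then show "x = y"
      using \<gamma>_pos by (simp add: mult_le_0_iff)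
  qed
  show "surj (noise_at G v)"
    unfolding surj_def
  proof
    fix w
    obtain \<theta> where "\<And>y. objective G v w \<theta> \<le> objective G v w y"
      by (rule objective_minimiser_exists) blast
    then show "\<exists>\<theta>. w = noise_at G v \<theta>"
      using objective_minimiser_noise_at by blast
  qed
qed

lemma continuous_inv_noise_at: "continuous_on UNIV (inv (noise_at G v))"
proof (rule lipschitz_on_continuous_on)
  show "(1 / \<gamma>)-lipschitz_on UNIV (inv (noise_at G v))"
  proof (rule lipschitz_onI)
    fix x y
    show "dist (inv (noise_at G v) x) (inv (noise_at G v) y) \<le> 1 / \<gamma> * dist x y"
      using noise_at_expansive[of "inv (noise_at G v) x" "inv (noise_at G v) y" G v] \<gamma>_pos
      unfolding surj_f_inv_f[OF bij_is_surj[OF bij_noise_at]] dist_norm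
      by (simp add: field_simps)
  qed (use \<gamma>_pos in simp)
qed

end

section \<open>Laplace noise\<close>

definition laplace_vec_density :: "real \<Rightarrow> real^'n \<Rightarrow> real" where
  "laplace_vec_density lam x = (\<Prod>i\<in>UNIV. laplace_density lam (x $ i))"

lemma laplace_density_nonneg: "0 < lam \<Longrightarrow> 0 \<le> laplace_density lam x"
  by (simp add: laplace_density_def)

lemma laplace_vec_density_nonneg: "0 < lam \<Longrightarrow> 0 \<le> laplace_vec_density lam x"
  by (simp add: laplace_vec_density_def laplace_density_nonneg prod_nonneg)

lemma measurable_laplace_density [measurable]: "laplace_density lam \<in> borel_measurable borel"
  unfolding laplace_density_def[abs_def] by measurable

lemma measurable_laplace_vec_density [measurable]:
  "(laplace_vec_density lam :: real^'n \<Rightarrow> real) \<in> borel_measurable borel"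
proof -
  have "(\<lambda>x :: real^'n. x $ i) \<in> borel_measurable borel" for i
    by (rule borel_measurable_continuous_onI) (rule continuous_on_component[OF continuous_on_id])
  then have "(\<lambda>x :: real^'n. laplace_density lam (x $ i)) \<in> borel_measurable borel" for i
    by (rule measurable_compose) (rule measurable_laplace_density)
  then show ?thesis
    unfolding laplace_vec_density_def[abs_def] by (rule borel_measurable_prod)
qed

text \<open>The triangle inequality in each exponent, multiplied over the coordinates: this is why
  sensitivity is measured in the 1-norm.\<close>

lemma laplace_vec_density_ratio:
  assumes "0 < lam"
  shows "laplace_vec_density lam x \<le> exp ((\<Sum>i\<in>UNIV. \<bar>x $ i - y $ i\<bar>) / lam) * laplace_vec_density lam y"
proof -
  have "laplace_density lam (x $ i) \<le> exp (\<bar>x $ i - y $ i\<bar> / lam) * laplace_density lam (y $ i)" for i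
  proof -
    have "- \<bar>x $ i\<bar> / lam \<le> \<bar>x $ i - y $ i\<bar> / lam + - \<bar>y $ i\<bar> / lam"
      using assms by (simp add: field_simps)
    then have "exp (- \<bar>x $ i\<bar> / lam) \<le> exp (\<bar>x $ i - y $ i\<bar> / lam) * exp (- \<bar>y $ i\<bar> / lam)"
      by (simp add: exp_add[symmetric])
    then have "1 / (2 * lam) * exp (- \<bar>x $ i\<bar> / lam)
        \<le> 1 / (2 * lam) * (exp (\<bar>x $ i - y $ i\<bar> / lam) * exp (- \<bar>y $ i\<bar> / lam))"
      using assms by (intro mult_left_mono) auto
    then show ?thesis
      unfolding laplace_density_def by (simp only: mult.left_commute)
  qed
  then have "laplace_vec_density lam x
      \<le> (\<Prod>i\<in>UNIV. exp (\<bar>x $ i - y $ i\<bar> / lam) * laplace_density lam (y $ i))"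
    unfolding laplace_vec_density_def by (intro prod_mono) (auto simp: laplace_density_nonneg assms)
  also have "\<dots> = exp ((\<Sum>i\<in>UNIV. \<bar>x $ i - y $ i\<bar>) / lam) * laplace_vec_density lam y"
    by (simp add: laplace_vec_density_def prod.distrib exp_sum sum_divide_distrib)
  finally show ?thesis .
qed

lemma prod_Basis_vec: "prod g (Basis :: (real^'n) set) = (\<Prod>i\<in>UNIV. g (axis i 1))"
proof -
  have "Basis = range (\<lambda>i :: 'n. axis i (1::real))"
    by (auto simp: Basis_vec_def)
  moreover have "inj (\<lambda>i :: 'n. axis i (1::real))"
    by (auto simp: inj_on_def axis_eq_axis)
  ultimately show ?thesis
    using prod.reindex[of "\<lambda>i :: 'n. axis i (1::real)" UNIV g] by (simp add: o_def)
qed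

lemma borel_measurable_vecI:
  fixes w :: "'w \<Rightarrow> real^'n"
  assumes "\<And>i. (\<lambda>\<omega>. w \<omega> $ i) \<in> borel_measurable M"
  shows "w \<in> borel_measurable M"
proof (subst borel_measurable_euclidean_space, rule ballI)
  fix b :: "real^'n" assume "b \<in> Basis"
  then obtain i where "b = axis i 1"
    by (auto simp: Basis_vec_def)
  then show "(\<lambda>\<omega>. w \<omega> \<bullet> b) \<in> borel_measurable M"
    using assms[of i] by (simp add: inner_axis)
qed

lemma iid_laplace_measurable:
  fixes w :: "'w \<Rightarrow> real^'n"
  assumes "iid_laplace P lam w"
  shows "w \<in> borel_measurable P"
proof (rule borel_measurable_vecI)
  fix i
  have "distributed P lborel (\<lambda>\<omega>. w \<omega> $ i) (\<lambda>x. ennreal (laplace_density lam x))"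
    using assms by (simp add: iid_laplace_def)
  from distributed_measurable[OF this] show "(\<lambda>\<omega>. w \<omega> $ i) \<in> borel_measurable P"
    by simp
qed

text \<open>Open boxes form an intersection-stable generator of the Borel sets, so it suffices to
  compare the measures there. On a box, independence gives a product of one-dimensional integrals,
  which the product structure of \<open>lborel\<close> reassembles into one integral of the joint
  density.\<close>

lemma distr_iid_laplace:
  fixes w :: "'w \<Rightarrow> real^'n"
  assumes "prob_space P" and iid: "iid_laplace P lam w" and "0 < lam"
  shows "distr P borel w = density lborel (\<lambda>x. ennreal (laplace_vec_density lam x))" (is "?L = ?R")
proof (rule measure_eqI_generator_eq)
  interpret prob_space P by fact
  note [measurable] = iid_laplace_measurable[OF iid]
  let ?E = "range (\<lambda>(a, b). box a b::(real^'n) set)"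
  show "Int_stable ?E"
    by (auto simp: Int_stable_def box_Int_box)
  show "?E \<subseteq> Pow UNIV" "sets ?L = sigma_sets UNIV ?E" "sets ?R = sigma_sets UNIV ?E"
    by (simp_all add: borel_eq_box)
  let ?A = "\<lambda>n::nat. box (- (real n *\<^sub>R One)) (real n *\<^sub>R One) :: (real^'n) set"
  show "range ?A \<subseteq> ?E" "(\<Union>i. ?A i) = UNIV"
    unfolding UN_box_eq_UNIV by auto
  show "emeasure ?L (?A i) \<noteq> \<infinity>" for i
    by (simp add: emeasure_distr)
  fix X assume "X \<in> ?E"
  then obtain l u where X: "X = box l u" by auto
  let ?B = "\<lambda>i. {l $ i <..< u $ i}"
  let ?I = "\<lambda>i. \<integral>\<^sup>+t. ennreal (laplace_density lam t) * indicator (?B i) t \<partial>lborel"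
  have "w -` X \<inter> space P = (\<Inter>i\<in>UNIV. (\<lambda>\<omega>. w \<omega> $ i) -` ?B i \<inter> space P)"
    by (auto simp: X mem_box_cart)
  then have "emeasure ?L X = ennreal (prob (\<Inter>i\<in>UNIV. (\<lambda>\<omega>. w \<omega> $ i) -` ?B i \<inter> space P))"
    by (simp add: X emeasure_distr emeasure_eq_measure)
  also have "\<dots> = ennreal (\<Prod>i\<in>UNIV. prob ((\<lambda>\<omega>. w \<omega> $ i) -` ?B i \<inter> space P))"
    using iid by (subst indep_varsD_finite) (auto simp: iid_laplace_def)
  also have "\<dots> = (\<Prod>i\<in>UNIV. emeasure P ((\<lambda>\<omega>. w \<omega> $ i) -` ?B i \<inter> space P))"
    by (simp add: prod_ennreal emeasure_eq_measure)
  also have "\<dots> = (\<Prod>i\<in>UNIV. ?I i)"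
  proof (rule prod.cong[OF refl])
    fix i
    have "distributed P lborel (\<lambda>\<omega>. w \<omega> $ i) (\<lambda>x. ennreal (laplace_density lam x))"
      using iid by (simp add: iid_laplace_def)
    then show "emeasure P ((\<lambda>\<omega>. w \<omega> $ i) -` ?B i \<inter> space P) = ?I i"
      by (rule distributed_emeasure) simp
  qed
  also have "\<dots> = (\<Prod>b\<in>Basis. \<integral>\<^sup>+t. ennreal (laplace_density lam t) * indicator {l \<bullet> b <..< u \<bullet> b} t \<partial>lborel)"
    by (simp add: prod_Basis_vec inner_axis)
  also have "\<dots> = (\<integral>\<^sup>+x. (\<Prod>b\<in>Basis. ennreal (laplace_density lam (x \<bullet> b)) * indicator {l \<bullet> b <..< u \<bullet> b} (x \<bullet> b)) \<partial>lborel)"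
    by (subst nn_integral_lborel_prod) auto
  also have "\<dots> = (\<integral>\<^sup>+x. ennreal (laplace_vec_density lam x) * indicator X x \<partial>lborel)"
  proof (rule nn_integral_cong)
    fix x :: "real^'n"
    have "(\<Prod>i\<in>UNIV. indicator (?B i) (x $ i) :: ennreal) = indicator X x"
      by (auto simp: X mem_box_cart split: split_indicator)
    then show "(\<Prod>b\<in>Basis. ennreal (laplace_density lam (x \<bullet> b)) * indicator {l \<bullet> b <..< u \<bullet> b} (x \<bullet> b))
        = ennreal (laplace_vec_density lam x) * indicator X x"
      by (simp add: prod_Basis_vec inner_axis prod.distrib laplace_vec_density_def prod_ennreal laplace_density_nonneg \<open>0 < lam\<close>)
  qed
  also have "\<dots> = emeasure ?R X"
    by (simp add: X emeasure_density)
  finally show "emeasure ?L X = emeasure ?R X" .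
qed

section \<open>Privacy of the perturbed minimiser\<close>

context convex_loss
begin

text \<open>Images become preimages under the continuous inverse, so they inherit Borel
  measurability.\<close>

lemma noise_at_image: "noise_at G v ` A = inv (noise_at G v) -` A"
  by (simp add: bij_vimage_eq_inv_image[OF bij_imp_bij_inv[OF bij_noise_at]] inv_inv_eq[OF bij_noise_at])

lemma noise_at_image_borel: "A \<in> sets borel \<Longrightarrow> noise_at G v ` A \<in> sets borel"
  unfolding noise_at_image
  by (rule measurable_sets_borel[OF borel_measurable_continuous_onI[OF continuous_inv_noise_at]])

text \<open>Change of variables along the injective map \<open>noise_at\<close>. The
  \<open>has_integral\<close> form lets the laws of two estimators be compared pointwise under the
  integral.\<close>

lemma measure_noise_at_image:
  fixes v :: "'e \<Rightarrow> real^'m::{finite,wellorder}" and p :: "real^'m::_ \<Rightarrow> real"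
  assumes A: "A \<in> sets borel" and p: "integrable lborel p" "\<And>x. 0 \<le> p x"
  shows "((\<lambda>\<theta>. \<bar>det (hessian G v \<theta>)\<bar> * p (noise_at G v \<theta>))
    has_integral measure (density lborel (\<lambda>x. ennreal (p x))) (noise_at G v ` A)) A"
proof -
  let ?T = "noise_at G v"
  let ?J = "\<lambda>\<theta>. \<bar>det (hessian G v \<theta>)\<bar> * p (?T \<theta>)"
  have TA: "?T ` A \<in> sets borel"
    by (rule noise_at_image_borel[OF A])
  have set_int: "set_integrable lborel (?T ` A) p"
    unfolding set_integrable_def using TA p(1) by (intro integrable_mult_indicator) auto
  \<comment> \<open>\<open>absolutely_integrable_on\<close> refers to Lebesgue measure, the
    completion of \<open>lborel\<close>.\<close>
  then have abs: "p absolutely_integrable_on ?T ` A"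
    unfolding set_integrable_def by (subst integrable_completion) (auto dest: borel_measurable_integrable)
  have "emeasure (density lborel (\<lambda>x. ennreal (p x))) (?T ` A)
      = (\<integral>\<^sup>+x. ennreal (indicator (?T ` A) x *\<^sub>R p x) \<partial>lborel)"
    using TA p(1) by (subst emeasure_density)
      (auto intro!: nn_integral_cong dest: borel_measurable_integrable split: split_indicator)
  then have "measure (density lborel (\<lambda>x. ennreal (p x))) (?T ` A) = (LINT x:?T ` A|lborel. p x)"
    unfolding set_lebesgue_integral_def measure_def
    using set_int p(2) by (subst integral_eq_nn_integral) (auto simp: set_integrable_def)
  also have "\<dots> = integral (?T ` A) p"
    by (rule set_borel_integral_eq_integral[OF set_int])
  finally have meas: "measure (density lborel (\<lambda>x. ennreal (p x))) (?T ` A) = integral (?T ` A) p" .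
  \<comment> \<open>The change of variables theorem speaks of functions with values in a
    \<open>vec\<close> type, so the scalar density is embedded into \<open>real^1\<close>.\<close>
  have "(\<lambda>\<theta>. \<bar>det (matrix (\<lambda>h. - (hessian G v \<theta> *v h)))\<bar> *\<^sub>R vec (p (?T \<theta>)) :: real^1) absolutely_integrable_on A \<and>
      integral A (\<lambda>\<theta>. \<bar>det (matrix (\<lambda>h. - (hessian G v \<theta> *v h)))\<bar> *\<^sub>R vec (p (?T \<theta>)) :: real^1) = vec (integral (?T ` A) p)"
  proof (subst has_absolute_integral_change_of_variables)
    show "A \<in> sets lebesgue"
      using A by (simp add: sets_completionI_sets)
    show "inj_on ?T A"
      using bij_noise_at by (meson bij_is_inj inj_on_subset subset_UNIV)
  qed (use abs noise_at_has_derivative in \<open>auto simp: absolutely_integrable_on_1_iff integral_on_1_eq\<close>)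
  then have "?J absolutely_integrable_on A" "integral A ?J = integral (?T ` A) p"
    by (simp_all add: abs_det_noise_at_derivative absolutely_integrable_on_1_iff integral_on_1_eq vec_eq_iff)
  then show ?thesis
    unfolding meas using set_lebesgue_integral_eq_integral(1) integrable_integral by metis
qed

lemma hessian_insert:
  assumes "finite C" "e \<notin> C"
  shows "hessian (insert e C) v \<theta> = hessian C v \<theta> + f'' (v e \<bullet> \<theta>) *\<^sub>R outer (v e) (v e)"
  using assms by (simp add: hessian_def)

lemma noise_at_insert:
  assumes "finite C" "e \<notin> C"
  shows "noise_at (insert e C) v \<theta> = noise_at C v \<theta> - f' (v e \<bullet> \<theta>) *\<^sub>R v e"
  using assms by (simp add: noise_at_def)

text \<open>An extra edge is a rank-one update with nonnegative weight, hence multiplies the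
  determinant by \<open>1 + f'' (v e \<bullet> \<theta>) * s\<close> with \<open>s \<ge> 0\<close>;
  then \<open>1 + x \<le> exp x\<close>. The second bound serves to remove an edge, the first to
  insert one.\<close>

lemma abs_det_hessian_insert_bounds:
  assumes "finite C" "e \<notin> C" and "f'' (v e \<bullet> \<theta>) \<le> \<kappa>"
  shows "\<bar>det (hessian C v \<theta>)\<bar> \<le> \<bar>det (hessian (insert e C) v \<theta>)\<bar>"
    and "\<bar>det (hessian (insert e C) v \<theta>)\<bar> \<le> exp (\<kappa> * (norm (v e))\<^sup>2 / \<gamma>) * \<bar>det (hessian C v \<theta>)\<bar>"
proof -
  obtain s where s: "0 \<le> s" "s \<le> (norm (v e))\<^sup>2 / \<gamma>"
    "\<And>h. det (hessian C v \<theta> + h *\<^sub>R outer (v e) (v e)) = det (hessian C v \<theta>) * (1 + h * s)"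
    using det_rank_one_update[OF \<gamma>_pos hessian_coercive] by blast
  have eq: "\<bar>det (hessian (insert e C) v \<theta>)\<bar> = \<bar>det (hessian C v \<theta>)\<bar> * (1 + f'' (v e \<bullet> \<theta>) * s)"
    unfolding hessian_insert[OF assms(1,2)] s(3) using s(1) f''_nonneg by (simp add: abs_mult)
  show "\<bar>det (hessian C v \<theta>)\<bar> \<le> \<bar>det (hessian (insert e C) v \<theta>)\<bar>"
    unfolding eq using s(1) f''_nonneg by (simp add: mult_le_cancel_left1)
  have "f'' (v e \<bullet> \<theta>) * s \<le> \<kappa> * ((norm (v e))\<^sup>2 / \<gamma>)"
    using s assms(3) f''_nonneg[of "v e \<bullet> \<theta>"] by (intro mult_mono) auto
  then have "1 + f'' (v e \<bullet> \<theta>) * s \<le> exp (\<kappa> * (norm (v e))\<^sup>2 / \<gamma>)"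
    using exp_ge_add_one_self[of "\<kappa> * (norm (v e))\<^sup>2 / \<gamma>"] unfolding times_divide_eq_right by linarith
  then show "\<bar>det (hessian (insert e C) v \<theta>)\<bar> \<le> exp (\<kappa> * (norm (v e))\<^sup>2 / \<gamma>) * \<bar>det (hessian C v \<theta>)\<bar>"
    unfolding eq by (metis abs_ge_zero mult.commute mult_right_mono)
qed

lemma hessian_cong: "(\<And>c. c \<in> C \<Longrightarrow> v c = v' c) \<Longrightarrow> hessian C v \<theta> = hessian C v' \<theta>"
  unfolding hessian_def by (intro arg_cong2[of _ _ _ _ plus] sum.cong refl) simp

lemma noise_at_cong: "(\<And>c. c \<in> C \<Longrightarrow> v c = v' c) \<Longrightarrow> noise_at C v \<theta> = noise_at C v' \<theta>"
  unfolding noise_at_def by (intro arg_cong2[of _ _ _ _ minus] arg_cong[of _ _ uminus] sum.cong refl) simp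

text \<open>Both kinds of adjacent data sets have the form \<open>insert e C\<close>, \<open>insert e' C\<close> with the same loss on \<open>C\<close>.
  The budget \<open>\<epsilon>\<close> is split evenly between the Jacobians and the noise densities.\<close>

lemma weighted_density_ratio:
  fixes v v' :: "'e \<Rightarrow> real^'n"
  assumes C: "finite C" "e \<notin> C" "e' \<notin> C" "\<And>c. c \<in> C \<Longrightarrow> v c = v' c"
    and f': "\<And>x. \<bar>f' x\<bar> \<le> \<kappa>\<^sub>1" and f'': "\<And>x. f'' x \<le> \<kappa>\<^sub>2"
    and v: "(\<Sum>i\<in>UNIV. \<bar>v e $ i\<bar>) \<le> 2" "(norm (v e))\<^sup>2 \<le> 2" "(\<Sum>i\<in>UNIV. \<bar>v' e' $ i\<bar>) \<le> 2"
    and "0 < \<epsilon>" "0 < lam" "8 * \<kappa>\<^sub>1 \<le> lam * \<epsilon>" "4 * \<kappa>\<^sub>2 \<le> \<gamma> * \<epsilon>"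
  shows "\<bar>det (hessian (insert e C) v \<theta>)\<bar> * laplace_vec_density lam (noise_at (insert e C) v \<theta>)
    \<le> exp \<epsilon> * (\<bar>det (hessian (insert e' C) v' \<theta>)\<bar> * laplace_vec_density lam (noise_at (insert e' C) v' \<theta>))"
proof -
  let ?H = "hessian (insert e C) v \<theta>" and ?H' = "hessian (insert e' C) v' \<theta>"
  let ?T = "noise_at (insert e C) v \<theta>" and ?T' = "noise_at (insert e' C) v' \<theta>"
  have \<kappa>\<^sub>1: "0 \<le> \<kappa>\<^sub>1" and \<kappa>\<^sub>2: "0 \<le> \<kappa>\<^sub>2"
    using f'[of 0] f''[of 0] f''_nonneg[of 0] by linarith+
  have common: "hessian C v \<theta> = hessian C v' \<theta>" "noise_at C v \<theta> = noise_at C v' \<theta>"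
    using C(4) by (blast intro: hessian_cong noise_at_cong)+
  \<comment> \<open>The comparison passes through the common part \<open>C\<close>: removing
    \<open>e\<close> costs an exponential factor, and inserting \<open>e'\<close> can only increase
    the determinant.\<close>
  have "\<bar>det ?H\<bar> \<le> exp (\<kappa>\<^sub>2 * (norm (v e))\<^sup>2 / \<gamma>) * \<bar>det (hessian C v \<theta>)\<bar>"
    by (rule abs_det_hessian_insert_bounds(2)[OF C(1,2) f''])
  also have "\<dots> \<le> exp (\<epsilon> / 2) * \<bar>det ?H'\<bar>"
  proof (intro mult_mono)
    have "\<kappa>\<^sub>2 * (norm (v e))\<^sup>2 \<le> \<kappa>\<^sub>2 * 2"
      using v(2) \<kappa>\<^sub>2 by (rule mult_left_mono)
    then have "\<kappa>\<^sub>2 * (norm (v e))\<^sup>2 \<le> \<epsilon> / 2 * \<gamma>"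
      using assms(13) by (simp add: mult.commute[of \<gamma>])
    then show "exp (\<kappa>\<^sub>2 * (norm (v e))\<^sup>2 / \<gamma>) \<le> exp (\<epsilon> / 2)"
      unfolding exp_le_cancel_iff pos_divide_le_eq[OF \<gamma>_pos] .
    show "\<bar>det (hessian C v \<theta>)\<bar> \<le> \<bar>det ?H'\<bar>"
      unfolding common(1) by (rule abs_det_hessian_insert_bounds(1)[OF C(1,3) f''])
  qed auto
  finally have det: "\<bar>det ?H\<bar> \<le> exp (\<epsilon> / 2) * \<bar>det ?H'\<bar>" .
  have edge: "(\<Sum>i\<in>UNIV. \<bar>f' t * x $ i\<bar>) \<le> \<kappa>\<^sub>1 * 2" if "(\<Sum>i\<in>UNIV. \<bar>x $ i\<bar>) \<le> 2" for t and x :: "real^'n"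
  proof -
    have "(\<Sum>i\<in>UNIV. \<bar>f' t * x $ i\<bar>) = \<bar>f' t\<bar> * (\<Sum>i\<in>UNIV. \<bar>x $ i\<bar>)"
      by (simp add: abs_mult sum_distrib_left)
    also have "\<dots> \<le> \<kappa>\<^sub>1 * 2"
      using that f' \<kappa>\<^sub>1 by (intro mult_mono) (auto intro: sum_nonneg)
    finally show ?thesis .
  qed
  \<comment> \<open>The terms of \<open>C\<close> and the ridge cancel, leaving the two exchanged
    edges, each of 1-norm at most \<open>2 * \<kappa>\<^sub>1\<close>.\<close>
  have "(\<Sum>i\<in>UNIV. \<bar>?T $ i - ?T' $ i\<bar>)
      = (\<Sum>i\<in>UNIV. \<bar>f' (v' e' \<bullet> \<theta>) * v' e' $ i - f' (v e \<bullet> \<theta>) * v e $ i\<bar>)"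
    unfolding noise_at_insert[OF C(1,2)] noise_at_insert[OF C(1,3)] common(2)
    by (simp add: algebra_simps)
  also have "\<dots> \<le> (\<Sum>i\<in>UNIV. \<bar>f' (v' e' \<bullet> \<theta>) * v' e' $ i\<bar> + \<bar>f' (v e \<bullet> \<theta>) * v e $ i\<bar>)"
    by (intro sum_mono) simp
  also have "\<dots> \<le> 4 * \<kappa>\<^sub>1"
    using edge[OF v(1), of "v e \<bullet> \<theta>"] edge[OF v(3), of "v' e' \<bullet> \<theta>"] by (simp add: sum.distrib)
  finally have "(\<Sum>i\<in>UNIV. \<bar>?T $ i - ?T' $ i\<bar>) \<le> \<epsilon> / 2 * lam"
    using assms(12) by (simp add: mult.commute[of lam])
  then have "(\<Sum>i\<in>UNIV. \<bar>?T $ i - ?T' $ i\<bar>) / lam \<le> \<epsilon> / 2"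
    unfolding pos_divide_le_eq[OF \<open>0 < lam\<close>] .
  then have "laplace_vec_density lam ?T \<le> exp (\<epsilon> / 2) * laplace_vec_density lam ?T'"
    using laplace_vec_density_ratio[OF \<open>0 < lam\<close>, of ?T ?T'] laplace_vec_density_nonneg[OF \<open>0 < lam\<close>, of ?T']
    by (meson exp_le_cancel_iff mult_right_mono order_trans)
  with det have "\<bar>det ?H\<bar> * laplace_vec_density lam ?T
      \<le> (exp (\<epsilon> / 2) * \<bar>det ?H'\<bar>) * (exp (\<epsilon> / 2) * laplace_vec_density lam ?T')"
    by (intro mult_mono) (auto simp: laplace_vec_density_nonneg \<open>0 < lam\<close>)
  also have "\<dots> = (exp (\<epsilon> / 2) * exp (\<epsilon> / 2)) * (\<bar>det ?H'\<bar> * laplace_vec_density lam ?T')"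
    by (simp only: mult_ac)
  also have "exp (\<epsilon> / 2) * exp (\<epsilon> / 2) = exp \<epsilon>"
    by (simp flip: exp_add)
  finally show ?thesis .
qed

text \<open>Both estimators have explicit densities by the change of variables, so the pointwise
  ratio bound is integrated over \<open>A\<close>.\<close>

lemma minimiser_privacy_wellorder:
  fixes v v' :: "'e \<Rightarrow> real^'m::{finite,wellorder}" and w :: "'w \<Rightarrow> real^'m::_"
  assumes C: "finite C" "e \<notin> C" "e' \<notin> C" "\<And>c. c \<in> C \<Longrightarrow> v c = v' c"
    and f': "\<And>x. \<bar>f' x\<bar> \<le> \<kappa>\<^sub>1" and f'': "\<And>x. f'' x \<le> \<kappa>\<^sub>2"
    and v: "(\<Sum>i\<in>UNIV. \<bar>v e $ i\<bar>) \<le> 2" "(norm (v e))\<^sup>2 \<le> 2" "(\<Sum>i\<in>UNIV. \<bar>v' e' $ i\<bar>) \<le> 2"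
    and params: "0 < \<epsilon>" "0 < lam" "8 * \<kappa>\<^sub>1 \<le> lam * \<epsilon>" "4 * \<kappa>\<^sub>2 \<le> \<gamma> * \<epsilon>"
    and P: "prob_space P" "iid_laplace P lam w"
    and M: "\<And>\<omega>. noise_at (insert e C) v (M \<omega>) = w \<omega>" "\<And>\<omega>. noise_at (insert e' C) v' (M' \<omega>) = w \<omega>"
    and A: "A \<in> sets borel"
  shows "measure P {\<omega>\<in>space P. M \<omega> \<in> A} \<le> exp \<epsilon> * measure P {\<omega>\<in>space P. M' \<omega> \<in> A}"
proof -
  interpret prob_space P by fact
  note [measurable] = iid_laplace_measurable[OF P(2)]
  let ?p = "laplace_vec_density lam :: real^'m::_ \<Rightarrow> real"
  let ?\<mu> = "density lborel (\<lambda>x. ennreal (?p x))"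
  have \<mu>: "distr P borel w = ?\<mu>"
    using P params(2) by (rule distr_iid_laplace)
  have p: "\<And>x. 0 \<le> ?p x"
    using params(2) by (rule laplace_vec_density_nonneg)
  have "(\<integral>\<^sup>+x. ennreal (?p x) \<partial>lborel) = emeasure ?\<mu> UNIV"
    by (simp add: emeasure_density)
  also have "\<dots> = 1"
    unfolding \<mu>[symmetric] by (simp add: emeasure_distr emeasure_space_1)
  \<comment> \<open>Integrability comes from total mass 1, as the density belongs to the law of
    \<open>w\<close>.\<close>
  finally have "integrable lborel ?p"
    by (intro integrableI_nonneg) (auto simp: p)
  note law = measure_noise_at_image[OF A this p]
  have prob: "measure P {\<omega>\<in>space P. N \<omega> \<in> A} = measure ?\<mu> (noise_at G u ` A)"
    if "\<And>\<omega>. noise_at G u (N \<omega>) = w \<omega>" for N G and u :: "'e \<Rightarrow> real^'m::_"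
  proof -
    have "N \<omega> \<in> A \<longleftrightarrow> w \<omega> \<in> noise_at G u ` A" for \<omega>
      using that[of \<omega>] bij_is_inj[OF bij_noise_at[of G u]] by (metis inj_image_mem_iff)
    then have "{\<omega>\<in>space P. N \<omega> \<in> A} = w -` (noise_at G u ` A) \<inter> space P"
      by auto
    then show ?thesis
      unfolding \<mu>[symmetric] by (simp add: measure_distr noise_at_image_borel[OF A])
  qed
  show ?thesis
    unfolding prob[OF M(1)] prob[OF M(2)]
    by (rule has_integral_le[OF law has_integral_mult_right[OF law]])
      (rule weighted_density_ratio[OF C f' f'' v params])
qed

end

section \<open>Transport to a well-ordered index type\<close>

text \<open>The library's change-of-variables theorem asks for an index type of class \<^class>\<open>wellorder\<close>, and a
  finite linear order is not syntactically an instance of it. The following copy is.\<close>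

datatype 'a wo_copy = Copy (uncopy: 'a)

lemma bij_Copy: "bij Copy"
  by (intro bijI' ) (auto intro: wo_copy.exhaust)

lemma UNIV_wo_copy: "UNIV = range Copy"
  by (rule bij_is_surj[OF bij_Copy, symmetric])

instance wo_copy :: (finite) finite
  by standard (simp add: UNIV_wo_copy)

instantiation wo_copy :: (linorder) linorder
begin

definition "x \<le> y \<longleftrightarrow> uncopy x \<le> uncopy y"
definition "x < y \<longleftrightarrow> uncopy x < uncopy y"

instance
  by standard (auto simp: less_eq_wo_copy_def less_wo_copy_def intro: wo_copy.expand)

end

text \<open>Well-founded induction on the number of predecessors, which is finite and strictly
  monotone.\<close>

instance wo_copy :: ("{finite,linorder}") wellorder
proof
  fix P :: "'a wo_copy \<Rightarrow> bool" and a :: "'a wo_copy"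
  assume step: "\<And>x. (\<And>y. y < x \<Longrightarrow> P y) \<Longrightarrow> P x"
  show "P a"
  proof (induction a rule: measure_induct_rule[of "\<lambda>x. card {y. y < x}"])
    case (less x)
    show ?case
    proof (rule step)
      fix y assume "y < x"
      then have "{z. z < y} \<subset> {z. z < x}"
        by force
      then show "P y"
        by (intro less psubset_card_mono) auto
    qed
  qed
qed

definition relabel :: "real^'n \<Rightarrow> (real, 'n wo_copy) vec" where
  "relabel x = (\<chi> i. x $ uncopy i)"

lemma relabel_nth [simp]: "relabel x $ i = x $ uncopy i"
  by (simp add: relabel_def)

lemma sum_wo_copy: "(\<Sum>i\<in>UNIV. g (uncopy i)) = (\<Sum>i\<in>UNIV. g i)"
  by (simp add: UNIV_wo_copy sum.reindex bij_is_inj[OF bij_Copy])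

lemma inner_relabel [simp]: "relabel x \<bullet> relabel y = x \<bullet> y" for x :: "real^'n"
  using sum_wo_copy[of "\<lambda>i. x $ i * y $ i"] by (simp add: inner_vec_def)

lemma norm_relabel [simp]: "norm (relabel x) = norm x" for x :: "real^'n"
  by (simp add: norm_eq_sqrt_inner)

lemma relabel_image: "relabel ` A = (\<lambda>x. \<chi> i. x $ Copy i) -` A" for A :: "(real^'n) set"
proof -
  have "relabel (\<chi> i. x $ Copy i) = x" for x :: "(real, 'n wo_copy) vec"
    by (simp add: vec_eq_iff)
  then have "(\<lambda>x. \<chi> i. x $ Copy i) -` A \<subseteq> relabel ` A"
    by (metis image_eqI subsetI vimageE)
  moreover have "relabel ` A \<subseteq> (\<lambda>x. \<chi> i. x $ Copy i) -` A"
    by auto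
  ultimately show ?thesis by blast
qed

lemma relabel_image_borel:
  fixes A :: "(real^'n) set"
  assumes "A \<in> sets borel"
  shows "relabel ` A \<in> sets borel"
  unfolding relabel_image
  by (rule measurable_sets_borel[OF borel_measurable_continuous_onI assms])
    (intro continuous_intros)

lemma relabel_in_image: "relabel x \<in> relabel ` A \<longleftrightarrow> x \<in> A"
proof -
  have "x = y" if "relabel x = relabel y" for y
    using that unfolding vec_eq_iff relabel_nth by (metis wo_copy.sel)
  then show ?thesis by auto
qed

text \<open>\<open>noise_at\<close> is built from inner products and linear combinations, and
  \<open>relabel\<close> respects both.\<close>

lemma (in convex_loss) noise_at_relabel:
  fixes v :: "'e \<Rightarrow> real^'n"
  shows "noise_at G (\<lambda>e. relabel (v e)) (relabel \<theta>) = relabel (noise_at G v \<theta>)"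
  by (simp add: noise_at_def vec_eq_iff)

text \<open>Independence concerns finite subfamilies, and an injective \<open>g\<close> carries each
  of these bijectively to a subfamily of the original; \<open>A'\<close> transports the events along
  the inverse.\<close>

lemma (in prob_space) indep_vars_reindex:
  assumes "inj_on g I" and indep: "indep_vars N X (g ` I)"
  shows "indep_vars (\<lambda>i. N (g i)) (\<lambda>i. X (g i)) I"
proof -
  have "prob (\<Inter>j\<in>J. A j) = (\<Prod>j\<in>J. prob (A j))"
    if J: "J \<subseteq> I" "J \<noteq> {}" "finite J"
      and A: "\<And>j. j \<in> J \<Longrightarrow> A j \<in> {X (g j) -` B \<inter> space M |B. B \<in> sets (N (g j))}" for A J
  proof -
    have inj: "inj_on g J"
      using assms(1) J(1) by (rule inj_on_subset)
    define A' where "A' k = A (the_inv_into J g k)" for k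
    have A': "A' (g j) = A j" if "j \<in> J" for j
      using the_inv_into_f_f[OF inj that] by (simp add: A'_def)
    have "\<forall>k\<in>g ` J. A' k \<in> {X k -` B \<inter> space M |B. B \<in> sets (N k)}"
    proof
      fix k assume "k \<in> g ` J"
      then obtain j where "j \<in> J" "k = g j" by blast
      then show "A' k \<in> {X k -` B \<inter> space M |B. B \<in> sets (N k)}"
        using A[of j] A'[of j] by simp
    qed
    moreover have "indep_sets (\<lambda>k. {X k -` B \<inter> space M |B. B \<in> sets (N k)}) (g ` I)"
      using indep unfolding indep_vars_def2 by blast
    ultimately have "prob (\<Inter>k\<in>g ` J. A' k) = (\<Prod>k\<in>g ` J. prob (A' k))"
      using J by (intro indep_setsD[where I = "g ` I"]) auto
    then show ?thesis
      using A' by (simp add: prod.reindex[OF inj])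
  qed
  moreover have "random_variable (N (g i)) (X (g i))" if "i \<in> I" for i
    using indep that unfolding indep_vars_def2 by blast
  ultimately show ?thesis
    unfolding indep_vars_def2 by (intro conjI ballI indep_setsI) (auto intro: measurable_sets)
qed

lemma iid_laplace_relabel:
  fixes w :: "'w \<Rightarrow> real^'n"
  assumes "prob_space P" "iid_laplace P lam w"
  shows "iid_laplace P lam (\<lambda>\<omega>. relabel (w \<omega>))"
proof -
  interpret prob_space P by fact
  have "range uncopy = (UNIV :: 'n set)"
    by (metis surjI wo_copy.sel)
  then have "indep_vars (\<lambda>_. borel) (\<lambda>i \<omega>. w \<omega> $ uncopy i) UNIV"
    using assms(2) indep_vars_reindex[of uncopy UNIV "\<lambda>_. borel" "\<lambda>i \<omega>. w \<omega> $ i"]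
    by (auto simp: iid_laplace_def inj_on_def intro: wo_copy.expand)
  then show ?thesis
    using assms(2) by (simp add: iid_laplace_def)
qed

text \<open>Relabelling preserves 1-norms, Euclidean norms, the Laplace law and the noise equation,
  so the bound transfers from the copied index type.\<close>

lemma (in convex_loss) minimiser_privacy:
  fixes v v' :: "'e \<Rightarrow> (real, 'n::{finite,linorder}) vec"
  assumes C: "finite C" "e \<notin> C" "e' \<notin> C" "\<And>c. c \<in> C \<Longrightarrow> v c = v' c"
    and f': "\<And>x. \<bar>f' x\<bar> \<le> \<kappa>\<^sub>1" and f'': "\<And>x. f'' x \<le> \<kappa>\<^sub>2"
    and v: "(\<Sum>i\<in>UNIV. \<bar>v e $ i\<bar>) \<le> 2" "(norm (v e))\<^sup>2 \<le> 2" "(\<Sum>i\<in>UNIV. \<bar>v' e' $ i\<bar>) \<le> 2"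
    and params: "0 < \<epsilon>" "0 < lam" "8 * \<kappa>\<^sub>1 \<le> lam * \<epsilon>" "4 * \<kappa>\<^sub>2 \<le> \<gamma> * \<epsilon>"
    and P: "prob_space P" "iid_laplace P lam w"
    and M: "\<And>\<omega>. noise_at (insert e C) v (M \<omega>) = w \<omega>" "\<And>\<omega>. noise_at (insert e' C) v' (M' \<omega>) = w \<omega>"
    and A: "A \<in> sets borel"
  shows "measure P {\<omega>\<in>space P. M \<omega> \<in> A} \<le> exp \<epsilon> * measure P {\<omega>\<in>space P. M' \<omega> \<in> A}"
proof -
  let ?v = "\<lambda>e. relabel (v e)" and ?v' = "\<lambda>e. relabel (v' e)"
  have "measure P {\<omega>\<in>space P. relabel (M \<omega>) \<in> relabel ` A}
      \<le> exp \<epsilon> * measure P {\<omega>\<in>space P. relabel (M' \<omega>) \<in> relabel ` A}"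
  proof (rule minimiser_privacy_wellorder[where v = ?v and v' = ?v' and w = "\<lambda>\<omega>. relabel (w \<omega>)"])
    show "?v c = ?v' c" if "c \<in> C" for c
      using C(4)[OF that] by simp
    show "(\<Sum>i\<in>UNIV. \<bar>?v e $ i\<bar>) \<le> 2" "(norm (?v e))\<^sup>2 \<le> 2" "(\<Sum>i\<in>UNIV. \<bar>?v' e' $ i\<bar>) \<le> 2"
      using v sum_wo_copy[of "\<lambda>i. \<bar>v e $ i\<bar>"] sum_wo_copy[of "\<lambda>i. \<bar>v' e' $ i\<bar>"] by simp_all
    show "noise_at (insert e C) ?v (relabel (M \<omega>)) = relabel (w \<omega>)"
      "noise_at (insert e' C) ?v' (relabel (M' \<omega>)) = relabel (w \<omega>)" for \<omega>
      by (simp_all only: noise_at_relabel M)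
  qed (fact C f' f'' params P(1) iid_laplace_relabel[OF P] relabel_image_borel[OF A])+
  then show ?thesis
    by (simp only: relabel_in_image)
qed

section \<open>The comparison likelihood\<close>

text \<open>With \<open>f = - ln \<circ> F\<close> and \<open>1 - F x = F (- x)\<close>, an edge contributes \<open>f (\<theta>\<^sub>i - \<theta>\<^sub>j)\<close> if \<open>i\<close> wins
  and \<open>f (\<theta>\<^sub>j - \<theta>\<^sub>i)\<close> if \<open>j\<close> wins.\<close>

definition edge_dir :: "('n \<Rightarrow> 'n \<Rightarrow> real) \<Rightarrow> 'n \<times> 'n \<Rightarrow> real^'n" where
  "edge_dir y = (\<lambda>(i, j). if y i j = 1 then axis i 1 - axis j 1 else axis j 1 - axis i 1)"

text \<open>Stated as an inequality because the pair \<open>e\<close> is arbitrary: for equal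
  endpoints the direction is zero.\<close>

lemma sum_abs_edge_dir:
  fixes y :: "'n::finite \<Rightarrow> 'n \<Rightarrow> real"
  shows "(\<Sum>k\<in>UNIV. \<bar>edge_dir y e $ k\<bar>) \<le> 2"
proof -
  have "(\<Sum>k\<in>UNIV. \<bar>(axis i 1 - axis j 1 :: real^'n) $ k\<bar>) \<le> 2" for i j :: 'n
  proof -
    have "(\<Sum>k\<in>UNIV. \<bar>(axis i 1 - axis j 1 :: real^'n) $ k\<bar>)
        \<le> (\<Sum>k\<in>UNIV. (if k = i then 1 else 0) + (if k = j then 1 else 0))"
      by (intro sum_mono) (simp add: axis_def)
    then show ?thesis
      by (simp add: sum.distrib)
  qed
  then show ?thesis
    by (auto simp: edge_dir_def split: prod.split)
qed

lemma norm_edge_dir: "(norm (edge_dir y e))\<^sup>2 \<le> 2"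
  by (auto simp: edge_dir_def power2_norm_eq_inner inner_diff_left inner_diff_right inner_axis_axis split: prod.split)

text \<open>Strict monotonicity keeps \<open>F\<close> off the endpoints of its range:
  \<open>F x\<close> lies strictly between \<open>F (x - 1)\<close> and
  \<open>F (x + 1)\<close>.\<close>

lemma cond_A0_bounds:
  assumes "cond_A0 F"
  shows "0 < F x" "F x < 1" "1 - F x = F (- x)"
proof -
  have range: "\<And>x. F x \<in> {0..1}" and mono: "strict_mono F" and refl: "F x = 1 - F (- x)"
    using assms unfolding cond_A0_def by blast+
  have "F (x - 1) < F x" "F x < F (x + 1)"
    using mono by (simp_all add: strict_mono_less)
  then show "0 < F x" "F x < 1"
    using range[of "x - 1"] range[of "x + 1"] by simp_all
  show "1 - F x = F (- x)"
    using refl by simp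
qed

lemma neg_log_lik_eq:
  assumes "cond_A0 F" "comparison_data (G, y)"
  shows "neg_log_lik F (G, y) \<theta> = (\<Sum>e\<in>G. - ln (F (edge_dir y e \<bullet> \<theta>)))"
  unfolding neg_log_lik_def prod.case
proof (rule sum.cong[OF refl], clarsimp)
  fix i j assume "(i, j) \<in> G"
  then have "y i j \<in> {0, 1}" "y j i = 1 - y i j"
    using assms(2) by (auto simp: comparison_data_def)
  then consider "y i j = 1" "y j i = 0" | "y i j = 0" "y j i = 1"
    by auto
  then show "- (y i j * ln (F (\<theta> $ i - \<theta> $ j))) - y j i * ln (1 - F (\<theta> $ i - \<theta> $ j))
      = - ln (F (edge_dir y (i, j) \<bullet> \<theta>))"
    by cases (simp_all add: edge_dir_def cond_A0_bounds(3)[OF assms(1)] inner_diff_left inner_axis')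
qed

lemma neg_log_has_derivatives:
  assumes "twice_differentiable F" "cond_A0 F"
  shows "((\<lambda>x. - ln (F x)) has_real_derivative - (deriv F x / F x)) (at x)"
    and "((\<lambda>x. - (deriv F x / F x)) has_real_derivative neg_log_deriv2 F x) (at x)"
proof -
  have F: "(F has_real_derivative deriv F x) (at x)" "(deriv F has_real_derivative deriv (deriv F) x) (at x)" for x
    using assms(1) by (auto simp: twice_differentiable_def DERIV_deriv_iff_real_differentiable)
  note pos = cond_A0_bounds(1)[OF assms(2)]
  have 1: "((\<lambda>x. - ln (F x)) has_real_derivative - (deriv F x / F x)) (at x)" for x
    using DERIV_minus[OF DERIV_chain2[OF DERIV_ln[OF pos[of x]] F(1)]]
    by (simp add: divide_inverse mult.commute)
  then show "((\<lambda>x. - ln (F x)) has_real_derivative - (deriv F x / F x)) (at x)" .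
  \<comment> \<open>Once the first derivative is identified as a function, mere differentiability of
    it suffices: its derivative is \<open>neg_log_deriv2 F\<close> by definition, with no formula to
    compute.\<close>
  have "deriv (\<lambda>x. - ln (F x)) = (\<lambda>x. - (deriv F x / F x))"
    using 1 by (intro ext DERIV_imp_deriv)
  moreover have "(\<lambda>x. - (deriv F x / F x)) differentiable at x"
    using DERIV_minus[OF DERIV_divide[OF F(2) F(1)]] pos[of x]
    unfolding real_differentiable_def by (metis less_irrefl)
  ultimately show "((\<lambda>x. - (deriv F x / F x)) has_real_derivative neg_log_deriv2 F x) (at x)"
    by (simp add: neg_log_deriv2_def DERIV_deriv_iff_real_differentiable)
qed

text \<open>\<open>deriv F\<close> is nonnegative and \<open>1 - F x\<close> lies between 0 and 1,
  so the extra factor in the denominator only enlarges the quotient bounded by (A1).\<close>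

lemma log_deriv_bound:
  assumes "twice_differentiable F" "cond_A0 F" "cond_A1 F \<kappa>\<^sub>1"
  shows "\<bar>- (deriv F x / F x)\<bar> \<le> \<kappa>\<^sub>1"
proof -
  have "(F has_real_derivative deriv F x) (at x)"
    using assms(1) by (auto simp: twice_differentiable_def DERIV_deriv_iff_real_differentiable)
  moreover have "mono_on UNIV F"
    using assms(2) unfolding cond_A0_def by (blast intro: strict_mono_mono)
  ultimately have nonneg: "0 \<le> deriv F x"
    by (intro mono_on_imp_deriv_nonneg[of UNIV F _ x]) auto
  have pos: "0 < F x" "F x < 1"
    using cond_A0_bounds[OF assms(2)] by auto
  have "deriv F x / F x \<le> deriv F x / (F x * (1 - F x))"
    using nonneg pos by (intro divide_left_mono) auto
  also have "\<dots> \<le> (SUP x. deriv F x / (F x * (1 - F x)))"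
    using assms(3) by (intro cSUP_upper) (auto simp: cond_A1_def)
  also have "\<dots> < \<kappa>\<^sub>1"
    using assms(3) by (simp add: cond_A1_def)
  finally show ?thesis
    using nonneg pos by simp
qed

lemma convex_loss_neg_log:
  assumes "twice_differentiable F" "cond_A0 F" "cond_A2 F \<kappa>\<^sub>2" "0 < \<gamma>"
  shows "convex_loss (\<lambda>x. - ln (F x)) (\<lambda>x. - (deriv F x / F x)) (neg_log_deriv2 F) \<gamma>"
proof
  show "0 \<le> - ln (F x)" for x
    using cond_A0_bounds[OF assms(2), of x] by simp
  show "0 \<le> neg_log_deriv2 F x" for x
    using assms(3) by (simp add: cond_A2_def less_imp_le)
qed (fact neg_log_has_derivatives[OF assms(1,2)] assms(4))+

text \<open>A flipped outcome counts as exchanging \<open>e\<close> for itself with a different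
  direction, so \<open>C\<close> is \<open>G - {e}\<close> and \<open>e' = e\<close>. For an
  exchanged edge \<open>C\<close> is the intersection. \<open>edge_dir\<close> reads only the stored
  orientation, so agreement of those outcomes is enough.\<close>

lemma adjacentE:
  assumes "adjacent (G, y) (G', y')"
  obtains C e e' where "finite C" "e \<notin> C" "e' \<notin> C" "G = insert e C" "G' = insert e' C"
    "\<And>c. c \<in> C \<Longrightarrow> edge_dir y c = edge_dir y' c"
    "comparison_data (G, y)" "comparison_data (G', y')"
proof -
  note adj = assms[unfolded adjacent_def split_beta fst_conv snd_conv]
  note data = conjunct1[OF adj] conjunct1[OF conjunct2[OF adj]]
  from conjunct2[OF conjunct2[OF adj]] consider
      e where "G = G'" "e \<in> G" "\<And>c. c \<in> G \<Longrightarrow> c \<noteq> e \<Longrightarrow> y (fst c) (snd c) = y' (fst c) (snd c)"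
    | e e' where "e \<notin> G \<inter> G'" "e' \<notin> G \<inter> G'" "G = insert e (G \<inter> G')" "G' = insert e' (G \<inter> G')"
        "\<And>c. c \<in> G \<inter> G' \<Longrightarrow> y (fst c) (snd c) = y' (fst c) (snd c)"
    by (elim disjE conjE ex1E exE) blast+
  then show thesis
  proof cases
    case 1
    show thesis
    proof (rule that[of "G - {e}" e e])
      show "edge_dir y c = edge_dir y' c" if "c \<in> G - {e}" for c
        using 1(3)[of c] that by (simp add: edge_dir_def split_beta)
    qed (use 1 data in auto)
  next
    case 2
    show thesis
    proof (rule that[of "G \<inter> G'" e e'])
      show "edge_dir y c = edge_dir y' c" if "c \<in> G \<inter> G'" for c
        using 2(5)[OF that] by (simp add: edge_dir_def split_beta)
    qed (fact 2 data finite)+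
  qed
qed

theorem proposition2p1:
  fixes F :: "real \<Rightarrow> real" and \<kappa>\<^sub>1 \<kappa>\<^sub>2 \<epsilon> \<gamma> lam :: real
    and P :: "'w measure" and w :: "'w \<Rightarrow> (real, 'n::{finite,linorder}) vec"
  assumes "twice_differentiable F"
    and "cond_A0 F" and "cond_A1 F \<kappa>\<^sub>1" and "cond_A2 F \<kappa>\<^sub>2"
    and "\<epsilon> > 0"
    and "lam \<ge> 8 * \<kappa>\<^sub>1 / \<epsilon>" and "\<gamma> \<ge> 4 * \<kappa>\<^sub>2 / \<epsilon>"
    and "prob_space P" and "iid_laplace P lam w"
  shows "edge_differentially_private P
    (\<lambda>(X :: 'n dataset) \<omega>. private_mle F \<gamma> X (w \<omega>)) \<epsilon> 0"
proof -
  have "0 < \<kappa>\<^sub>1" "0 < \<kappa>\<^sub>2"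
    using assms(3,4) by (simp_all add: cond_A1_def cond_A2_def)
  then have "0 < 8 * \<kappa>\<^sub>1 / \<epsilon>" "0 < 4 * \<kappa>\<^sub>2 / \<epsilon>"
    using assms(5) by simp_all
  then have lam: "0 < lam" and \<gamma>: "0 < \<gamma>"
    using assms(6,7) by linarith+
  have params: "8 * \<kappa>\<^sub>1 \<le> lam * \<epsilon>" "4 * \<kappa>\<^sub>2 \<le> \<gamma> * \<epsilon>"
    using assms(6,7) by (simp_all add: pos_divide_le_eq[OF assms(5)])
  interpret convex_loss "\<lambda>x. - ln (F x)" "\<lambda>x. - (deriv F x / F x)" "neg_log_deriv2 F" \<gamma>
    using assms(1,2,4) \<gamma> by (rule convex_loss_neg_log)
  \<comment> \<open>Since a minimiser exists, \<open>arg_min\<close> attains the minimum, and its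
    choice satisfies the first-order condition.\<close>
  have mle: "noise_at G (edge_dir y) (private_mle F \<gamma> (G, y) u) = u"
    if "comparison_data (G, y)" for G y and u :: "(real, 'n) vec"
  proof (rule objective_minimiser_noise_at)
    fix x
    obtain \<theta> where \<theta>: "\<And>y'. objective G (edge_dir y) u \<theta> \<le> objective G (edge_dir y) u y'"
      by (rule objective_minimiser_exists) blast
    have "private_mle F \<gamma> (G, y) u = arg_min (objective G (edge_dir y) u) (\<lambda>_. True)"
      by (simp add: private_mle_def objective_def[abs_def] neg_log_lik_eq[OF assms(2) that])
    also have "objective G (edge_dir y) u \<dots> = objective G (edge_dir y) u \<theta>"
      by (rule arg_min_equality) (use \<theta> in auto)
    finally show "objective G (edge_dir y) u (private_mle F \<gamma> (G, y) u) \<le> objective G (edge_dir y) u x"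
      using \<theta> by simp
  qed
  have "(\<lambda>\<omega>. private_mle F \<gamma> X (w \<omega>)) \<in> borel_measurable P" if "comparison_data X" for X :: "'n dataset"
  proof -
    obtain G y where X: "X = (G, y)"
      by (cases X) blast
    \<comment> \<open>The noise equation identifies the estimator with the continuous inverse of
      \<open>noise_at\<close>, whence its measurability.\<close>
    have "private_mle F \<gamma> X = inv (noise_at G (edge_dir y))"
      unfolding X by (rule ext, subst bij_inv_eq_iff[OF bij_noise_at], rule mle[OF that[unfolded X]])
    then show ?thesis
      using measurable_compose[OF iid_laplace_measurable[OF assms(9)]
          borel_measurable_continuous_onI[OF continuous_inv_noise_at]] by simp
  qed
  moreover have "measure P {\<omega>\<in>space P. private_mle F \<gamma> X (w \<omega>) \<in> A}
      \<le> exp \<epsilon> * measure P {\<omega>\<in>space P. private_mle F \<gamma> X' (w \<omega>) \<in> A}"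
    if "adjacent X X'" "A \<in> sets borel" for X X' :: "'n dataset" and A
  proof -
    obtain G y where "X = (G, y)" by (cases X) blast
    moreover obtain G' y' where "X' = (G', y')" by (cases X') blast
    ultimately have X: "X = (G, y)" "X' = (G', y')" .
    from that(1) obtain C e e' where C: "finite C" "e \<notin> C" "e' \<notin> C"
      "\<And>c. c \<in> C \<Longrightarrow> edge_dir y c = edge_dir y' c"
      and G: "G = insert e C" "G' = insert e' C"
      and data: "comparison_data (G, y)" "comparison_data (G', y')"
      unfolding X by (rule adjacentE) blast
    have \<kappa>\<^sub>2: "neg_log_deriv2 F x \<le> \<kappa>\<^sub>2" for x
      using assms(4) by (simp add: cond_A2_def less_imp_le)
    show ?thesis
      unfolding X
      by (rule minimiser_privacy[OF C log_deriv_bound[OF assms(1-3)] \<kappa>\<^sub>2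
            sum_abs_edge_dir norm_edge_dir sum_abs_edge_dir assms(5) lam params assms(8,9)
            mle[OF data(1), unfolded G] mle[OF data(2), unfolded G] that(2), folded G])
  qed
  ultimately show ?thesis
    unfolding edge_differentially_private_def add_0_right using assms(8) by blast
qed

end
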